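(* Let $n>1$, let $F\colon\{0,1\}^n\to\{0,1\}$ be an $n$-dimensional truth-table, and let $\alpha\in 2^\omega$ be proper. Then \[ s^F_\alpha \equiv_{sW} s^{\oplus_{l(F)}}_\alpha. \]
   Context: Cantor space $2^\omega$ carries the lexicographic order $<_{lex}$. For $\alpha\in2^\omega$, $s_\alpha\colon 2^\omega\to\{0,1\}$ is $s_\alpha(x)=0$ if $x<_{lex}\alpha$ and $s_\alpha(x)=1$ if $x\ge_{lex}\alpha$. A sequence $\alpha\in2^\omega$ is proper if it contains infinitely many $1$'s. For an $m$-dimensional truth-table $G\colon\{0,1\}^m\to\{0,1\}$ and $\alpha_1,\dots,\alpha_m\in2^\omega$, $s^G_{\alpha_1,\dots,\alpha_m}\colon(2^\omega)^m\to\{0,1\}$ is $(x_1,\dots,x_m)\mapsto G(s_{\alpha_1}(x_1),\dots,s_{\alpha_m}(x_m))$, and $s^G_\alpha$ abbreviates $s^G_{\alpha,\dots,\alpha}$ (all $m$ thresholds equal to $\alpha$). $\oplus_m$ denotes the $m$-dimensional truth-table computing addition modulo $2$ of its $m$ input bits. For $v,v'\in\{0,1\}^n$, write $v\subseteq v'$ if $v(j)=1$ implies $v'(j)=1$ for all $j$, and $v\subset v'$ if additionally $v\neq v'$. For a truth-table $F$, $l(F)=k-1$ where $k$ is the length of a longest sequence $v_1\subset v_2\subset\dots\subset v_k$ in $\{0,1\}^{n}$ with $F(v_i)\neq F(v_{i+1})$ for all $i<k$. Weihrauch reducibility: for functions $f,g$ between spaces that are finite products of $2^\omega$, $\mathbb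 N$, $\{0,1\}$, we write $f\le_W g$ if there are computable (Turing) functionals $\Phi,\Psi$ with $f(x)=\Psi(x,g(\Phi(x)))$ for all $x$ in the domain of $f$, and $f\le_{sW}g$ (strong Weihrauch reducibility) if $f(x)=\Psi(g(\Phi(x)))$ for all such $x$; $\equiv_W$, $\equiv_{sW}$ denote reducibility in both directions. *)

theory Defs
  imports Main "HOL-Library.Fun_Lexorder"
begin

section \<open>Computable functionals\<close>

text \<open>Turing functionals are given by the partial recursive functions relative to an oracle. The
  oracle is queried with two numbers: the position of a component in the input tuple, and an
  argument for (the name of) that component.\<close>

datatype prog =
    Zero
  | Succ
  | Proj nat
  | Oracle
  | Comp prog "prog list"
  | PrimRec prog prog
  | Mu prog

inductive eval :: "(nat \<Rightarrow> nat \<Rightarrow> nat) \<Rightarrow> prog \<Rightarrow> nat list \<Rightarrow> nat \<Rightarrow> bool" for p where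
  Zero: "eval p Zero xs 0"
| Succ: "eval p Succ [x] (Suc x)"
| Proj: "i < length xs \<Longrightarrow> eval p (Proj i) xs (xs ! i)"
| Oracle: "eval p Oracle [i, k] (p i k)"
| Comp: "list_all2 (\<lambda>g y. eval p g xs y) gs ys \<Longrightarrow> eval p f ys z \<Longrightarrow> eval p (Comp f gs) xs z"
| PrimRec_0: "eval p f xs y \<Longrightarrow> eval p (PrimRec f g) (0 # xs) y"
| PrimRec_Suc: "eval p (PrimRec f g) (k # xs) y \<Longrightarrow> eval p g (k # y # xs) z \<Longrightarrow>
    eval p (PrimRec f g) (Suc k # xs) z"
| Mu: "eval p f (k # xs) 0 \<Longrightarrow> \<forall>j<k. \<exists>y. eval p f (j # xs) (Suc y) \<Longrightarrow> eval p (Mu f) xs k"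

inductive_cases eval_ZeroE: "eval p Zero xs z"
inductive_cases eval_SuccE: "eval p Succ xs z"
inductive_cases eval_ProjE: "eval p (Proj i) xs z"
inductive_cases eval_OracleE: "eval p Oracle xs z"
inductive_cases eval_CompE: "eval p (Comp f gs) xs z"
inductive_cases eval_PrimRec_0E: "eval p (PrimRec f g) (0 # xs) z"
inductive_cases eval_PrimRec_SucE: "eval p (PrimRec f g) (Suc k # xs) z"
inductive_cases eval_MuE: "eval p (Mu f) xs z"

lemma eval_deterministic:
  assumes "eval p e xs y" "eval p e xs z"
  shows "y = z"
  using assms
proof (induction arbitrary: z rule: eval.induct)
  case (Comp xs gs ys f w)
  from Comp.prems obtain zs where zs: "list_all2 (\<lambda>g y. eval p g xs y) gs zs" "eval p f zs z"
    by (rule eval_CompE)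
  have "ys = zs"
    using Comp.IH(1) zs(1) by (auto simp: list_all2_conv_all_nth intro: nth_equalityI)
  with Comp.IH(2) zs(2) show ?case by blast
next
  case (PrimRec_0 f xs y g)
  from PrimRec_0.prems have "eval p f xs z" by (rule eval_PrimRec_0E)
  with PrimRec_0.IH show ?case by blast
next
  case (PrimRec_Suc f g k xs y w)
  from PrimRec_Suc.prems obtain v where "eval p (PrimRec f g) (k # xs) v"
      "eval p g (k # v # xs) z"
    by (rule eval_PrimRec_SucE)
  with PrimRec_Suc.IH show ?case by blast
next
  case (Mu f k xs)
  from Mu.prems obtain z: "eval p f (z # xs) 0" "\<forall>j<z. \<exists>y. eval p f (j # xs) (Suc y)"
    by (rule eval_MuE)
  show ?case
  proof (rule linorder_cases[of k z])
    assume "k < z"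
    with z(2) obtain y where "eval p f (k # xs) (Suc y)" by blast
    with Mu.IH(1)[of "Suc y"] show ?thesis by simp
  next
    assume "z < k"
    with Mu.IH(2) obtain y where "\<forall>x. eval p f (z # xs) x \<longrightarrow> Suc y = x" by blast
    with z(1) show ?thesis by blast
  qed
qed (auto elim!: eval_ZeroE eval_SuccE eval_ProjE eval_OracleE)

text \<open>Points of finite products of \<open>2\<^sup>\<omega>\<close>, \<open>\<nat>\<close> and \<open>{0,1}\<close>, with \<open>True\<close> for the bit \<open>1\<close>.\<close>

type_synonym cantor = "nat \<Rightarrow> bool"

datatype factor = Cantor | Naturals | Bits

datatype component = Seq (seq: cantor) | Num nat | Bit bool

type_synonym point = "component list"

fun factor_of :: "component \<Rightarrow> factor" where
  "factor_of (Seq x) = Cantor"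
| "factor_of (Num m) = Naturals"
| "factor_of (Bit b) = Bits"

definition points :: "factor list \<Rightarrow> point set" where
  "points X = {x. map factor_of x = X}"

text \<open>Numbers and bits are named by constant functions, so that every component is presented to a
  functional, and produced by it, in the same way.\<close>

fun component_name :: "component \<Rightarrow> nat \<Rightarrow> nat" where
  "component_name (Seq x) k = of_bool (x k)"
| "component_name (Num m) k = m"
| "component_name (Bit b) k = of_bool b"

definition name :: "point \<Rightarrow> nat \<Rightarrow> nat \<Rightarrow> nat" where
  "name x i k = (if i < length x then component_name (x ! i) k else 0)"

text \<open>The domain of a computable functional is not required to be maximal: restrictions of
  functionals computed by a program count as well.\<close>

definition computable_functional :: "(point \<rightharpoonup> point) \<Rightarrow> bool" where
  "computable_functional \<Phi> \<longleftrightarrow>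
     (\<exists>X Y. dom \<Phi> \<subseteq> points X \<and> ran \<Phi> \<subseteq> points Y) \<and>
     (\<exists>e. \<forall>x y. \<Phi> x = Some y \<longrightarrow>
        (\<forall>j<length y. \<forall>k. eval (name x) e [j, k] (name y j k)))"

definition strong_Weihrauch_le :: "(point \<rightharpoonup> point) \<Rightarrow> (point \<rightharpoonup> point) \<Rightarrow> bool"
    (infix "\<le>\<^sub>s\<^sub>W" 50) where
  "f \<le>\<^sub>s\<^sub>W g \<longleftrightarrow> (\<exists>\<Phi> \<Psi>. computable_functional \<Phi> \<and> computable_functional \<Psi> \<and>
     (\<forall>x\<in>dom f. f x = (\<Psi> \<circ>\<^sub>m (g \<circ>\<^sub>m \<Phi>)) x))"

definition strong_Weihrauch_equiv :: "(point \<rightharpoonup> point) \<Rightarrow> (point \<rightharpoonup> point) \<Rightarrow> bool"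
    (infix "\<equiv>\<^sub>s\<^sub>W" 50) where
  "f \<equiv>\<^sub>s\<^sub>W g \<longleftrightarrow> f \<le>\<^sub>s\<^sub>W g \<and> g \<le>\<^sub>s\<^sub>W f"

section \<open>Truth-tables and step functions\<close>

definition step :: "cantor \<Rightarrow> cantor \<Rightarrow> bool" where
  "step \<alpha> x \<longleftrightarrow> \<not> less_fun x \<alpha>"

definition proper :: "cantor \<Rightarrow> bool" where
  "proper \<alpha> \<longleftrightarrow> infinite {k. \<alpha> k}"

text \<open>An \<open>m\<close>-dimensional truth-table is a function on \<^typ>\<open>bool list\<close> of which only the values on
  lists of length \<open>m\<close> matter.\<close>

type_synonym truth_table = "bool list \<Rightarrow> bool"

definition step_table :: "truth_table \<Rightarrow> cantor list \<Rightarrow> point \<rightharpoonup> point" where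
  "step_table G \<alpha>s x =
     (if x \<in> points (replicate (length \<alpha>s) Cantor)
      then Some [Bit (G (map2 step \<alpha>s (map seq x)))] else None)"

definition parity :: truth_table where
  "parity v \<longleftrightarrow> odd (\<Sum>b\<leftarrow>v. of_bool b :: nat)"

definition bits_le :: "bool list \<Rightarrow> bool list \<Rightarrow> bool" where
  "bits_le v w \<longleftrightarrow> list_all2 (\<longrightarrow>) v w"

definition bits_less :: "bool list \<Rightarrow> bool list \<Rightarrow> bool" where
  "bits_less v w \<longleftrightarrow> bits_le v w \<and> v \<noteq> w"

definition alternating_chain :: "nat \<Rightarrow> truth_table \<Rightarrow> bool list list \<Rightarrow> bool" where
  "alternating_chain n F vs \<longleftrightarrow>
     (\<forall>v\<in>set vs. length v = n) \<and> successively (\<lambda>v w. bits_less v w \<and> F v \<noteq> F w) vs"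

definition alternation :: "nat \<Rightarrow> truth_table \<Rightarrow> nat" where
  "alternation n F = Max (length ` {vs. alternating_chain n F vs}) - 1"

text \<open>The maximum is over a finite set, and over one containing \<open>1\<close>.\<close>

lemma bits_less_count:
  assumes "bits_less v w"
  shows "count_list v True < count_list w True"
proof -
  have "count_list v True \<le> count_list w True \<and>
      (count_list v True = count_list w True \<longrightarrow> v = w)"
    (is "?P v w")
  proof -
    have "list_all2 (\<longrightarrow>) v w"
      using assms by (simp add: bits_less_def bits_le_def)
    then show "?P v w"
      by (induction v w rule: list_all2_induct) auto
  qed
  then show ?thesis
    using assms by (auto simp: bits_less_def)
qed

lemma alternating_chain_length:
  assumes "alternating_chain n F vs"
  shows "length vs \<le> n + 1"
proof -
  have "successively (<) (map (\<lambda>v. count_list v True) vs)"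
    unfolding successively_map
    by (rule successively_mono[of "\<lambda>v w. bits_less v w \<and> F v \<noteq> F w"])
      (use assms in \<open>simp_all add: alternating_chain_def bits_less_count\<close>)
  then have "sorted_wrt (<) (map (\<lambda>v. count_list v True) vs)"
    by (simp add: successively_conv_sorted_wrt)
  then have d: "distinct (map (\<lambda>v. count_list v True) vs)"
    using strict_sorted_iff by blast
  have "set (map (\<lambda>v. count_list v True) vs) \<subseteq> {..n}"
  proof
    fix c assume "c \<in> set (map (\<lambda>v. count_list v True) vs)"
    then obtain v where "v \<in> set vs" "c = count_list v True" by auto
    moreover from this have "length v = n" using assms by (simp add: alternating_chain_def)
    ultimately show "c \<in> {..n}" using count_le_length[of v True] by simp
  qed
  then have "card (set (map (\<lambda>v. count_list v True) vs)) \<le> card {..n}"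
    by (intro card_mono) simp_all
  then show ?thesis
    using distinct_card[OF d] by simp
qed

lemma finite_alternating_chain_lengths: "finite (length ` {vs. alternating_chain n F vs})"
  by (rule finite_subset[of _ "{..n + 1}"]) (auto dest: alternating_chain_length)

lemma alternating_chain_singleton: "length v = n \<Longrightarrow> alternating_chain n F [v]"
  by (simp add: alternating_chain_def)

end

(* Lexicographic minimum and maximum are computable, and the step function at \<alpha> turns them into
   conjunction and disjunction. Hence for every monotone M there is a computable map c, not referring
   to \<alpha>, with step \<alpha> (c x1 ... xn) = M (step \<alpha> x1, ..., step \<alpha> xn).

   Reducing F to parity: let A(u) be the largest number of alternations of a chain that starts at a
   vector where F has the value F(0...0) and ends below u. Then A is monotone and bounded by l(F),
   and F(u) = F(0...0) + A(u) mod 2, because a chain ending in another value than F(u) can be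
   prolonged by u. So the l(F) monotone conditions i < A(u) have the parity F(u) + F(0...0).

   Reducing parity to F: along a longest alternating chain v0, v1, ..., the vector v_c, where c is
   the number of ones of u, depends monotonically on u, and F(v_c) = F(v_0) + c mod 2. *)

theory Submission imports Defs
begin

section \<open>Programs\<close>

lemma eval_Comp1:
  "eval p g xs y \<Longrightarrow> eval p f [y] z \<Longrightarrow> eval p (Comp f [g]) xs z"
  by (rule eval.Comp[of _ _ _ "[y]"]) simp_all

lemma eval_Comp2:
  "eval p g xs y \<Longrightarrow> eval p g' xs y' \<Longrightarrow> eval p f [y, y'] z \<Longrightarrow> eval p (Comp f [g, g']) xs z"
  by (rule eval.Comp[of _ _ _ "[y, y']"]) simp_all

lemma eval_Comp3:
  "eval p g xs y \<Longrightarrow> eval p g' xs y' \<Longrightarrow> eval p g'' xs y'' \<Longrightarrow> eval p f [y, y', y''] z \<Longrightarrow>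
    eval p (Comp f [g, g', g'']) xs z"
  by (rule eval.Comp[of _ _ _ "[y, y', y'']"]) simp_all

lemma eval_Proj: "i < length xs \<Longrightarrow> xs ! i = y \<Longrightarrow> eval p (Proj i) xs y"
  using eval.Proj by blast

fun const_prog :: "nat \<Rightarrow> prog" where
  "const_prog 0 = Zero"
| "const_prog (Suc m) = Comp Succ [const_prog m]"

lemma eval_const_prog: "eval p (const_prog m) xs m"
  by (induction m) (auto intro: eval.Zero eval_Comp1 eval.Succ)

text \<open>In the step of \<open>PrimRec\<close>, argument 0 is the predecessor, argument 1 the
  previous value, and the parameters start at 2; the projections in the steps below follow this
  numbering.\<close>

definition "pred_prog = PrimRec Zero (Proj 0)"

lemma eval_pred_prog: "eval p pred_prog [k] (k - 1)"
proof (induction k)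
  case 0
  show ?case by (simp add: pred_prog_def eval.PrimRec_0 eval.Zero)
next
  case (Suc k)
  have "eval p (Proj 0) [k, k - 1] k"
    by (rule eval_Proj) simp_all
  with Suc show ?case
    by (simp add: pred_prog_def eval.PrimRec_Suc)
qed

definition "add_prog = PrimRec (Proj 0) (Comp Succ [Proj 1])"

lemma eval_add_prog: "eval p add_prog [a, b] (a + b)"
proof (induction a)
  case 0
  show ?case by (auto simp: add_prog_def intro!: eval.PrimRec_0 eval_Proj)
next
  case (Suc a)
  have "eval p (Comp Succ [Proj 1]) [a, a + b, b] (Suc (a + b))"
    by (rule eval_Comp1[OF eval_Proj eval.Succ]) simp_all
  with Suc show ?case
    by (simp add: add_prog_def eval.PrimRec_Suc)
qed

definition "monus_prog = PrimRec (Proj 0) (Comp pred_prog [Proj 1])"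

lemma eval_monus_prog: "eval p monus_prog [a, b] (b - a)"
proof (induction a)
  case 0
  show ?case by (auto simp: monus_prog_def intro!: eval.PrimRec_0 eval_Proj)
next
  case (Suc a)
  have "eval p (Comp pred_prog [Proj 1]) [a, b - a, b] (b - a - 1)"
    by (rule eval_Comp1[OF eval_Proj eval_pred_prog]) simp_all
  with Suc show ?case
    by (simp add: monus_prog_def eval.PrimRec_Suc)
qed

text \<open>Recursion serves as a zero test: the base case returns the first parameter, while the
  step ignores the previous value and returns the second parameter, its argument 3.\<close>

definition "cond_prog = PrimRec (Proj 0) (Proj 3)"

lemma eval_cond_prog: "eval p cond_prog [c, a, b] (if c = 0 then a else b)"
proof (induction c)
  case 0
  show ?case by (auto simp: cond_prog_def intro!: eval.PrimRec_0 eval_Proj)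
next
  case (Suc c)
  have "eval p (Proj 3) [c, if c = 0 then a else b, a, b] b"
    by (rule eval_Proj) simp_all
  with Suc show ?case
    by (simp add: cond_prog_def eval.PrimRec_Suc)
qed

text \<open>Bundles one program per output component into a single program. Each level of recursion
  on the component number peels off one list entry, and \<open>Proj 2\<close> passes on the
  position.\<close>

fun case_prog :: "prog list \<Rightarrow> prog" where
  "case_prog [] = Zero"
| "case_prog (e # es) = PrimRec e (Comp (case_prog es) [Proj 0, Proj 2])"

lemma eval_case_prog:
  assumes "\<And>i k. i < length es \<Longrightarrow> eval p (es ! i) [k] (f i k)"
  shows "eval p (case_prog es) [j, k] (if j < length es then f j k else 0)"
  using assms
proof (induction es arbitrary: f j)
  case Nil
  show ?case by (simp add: eval.Zero)
next
  case (Cons e es)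
  have IH: "eval p (case_prog es) [i, k] (if i < length es then f (Suc i) k else 0)" for i
    by (rule Cons.IH) (use Cons.prems[of "Suc _"] in simp)
  show ?case
  \<comment> \<open>The step discards the previous value, but \<open>PrimRec\<close> evaluates only
    if that value exists, so its existence is carried along by induction.\<close>
  proof (induction j)
    case 0
    show ?case using Cons.prems[of 0 k] by (simp add: eval.PrimRec_0)
  next
    case (Suc j)
    have "eval p (Comp (case_prog es) [Proj 0, Proj 2]) [j, y, k]
        (if j < length es then f (Suc j) k else 0)" for y
      by (rule eval_Comp2[OF eval_Proj eval_Proj IH]) simp_all
    with Suc show ?case by (simp add: eval.PrimRec_Suc)
  qed
qed

section \<open>Lexicographic minimum and maximum\<close>

text \<open>The first \<open>k\<close> bits, read as a binary number.\<close>

fun prefix_value :: "cantor \<Rightarrow> nat \<Rightarrow> nat" where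
  "prefix_value x 0 = 0"
| "prefix_value x (Suc k) = prefix_value x k + prefix_value x k + of_bool (x k)"

definition "prefix_prog e =
  PrimRec Zero (Comp add_prog [Comp add_prog [Proj 1, Proj 1], Comp e [Proj 0]])"

lemma eval_prefix_prog:
  assumes "\<And>k. eval p e [k] (of_bool (x k))"
  shows "eval p (prefix_prog e) [k] (prefix_value x k)"
proof (induction k)
  case 0
  show ?case by (simp add: prefix_prog_def eval.PrimRec_0 eval.Zero)
next
  case (Suc k)
  let ?v = "prefix_value x k"
  have "eval p (Comp add_prog [Proj 1, Proj 1]) [k, ?v] (?v + ?v)"
    by (rule eval_Comp2[OF eval_Proj eval_Proj eval_add_prog]) simp_all
  moreover have "eval p (Comp e [Proj 0]) [k, ?v] (of_bool (x k))"
    by (rule eval_Comp1[OF eval_Proj assms]) simp_all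
  ultimately have "eval p (Comp add_prog [Comp add_prog [Proj 1, Proj 1], Comp e [Proj 0]]) [k, ?v]
      (prefix_value x (Suc k))"
    using eval_Comp2[OF _ _ eval_add_prog] by simp
  with Suc show ?case
    by (simp add: prefix_prog_def eval.PrimRec_Suc del: prefix_value.simps)
qed

text \<open>The truncated difference, subtrahend first, vanishes exactly when the first prefix is at
  most the second, so it drives the zero test. The argument program \<open>Succ\<close> makes the
  prefixes k + 1 bits long, so that bit k is included.\<close>

definition "select_prog e e' d d' =
  Comp cond_prog [Comp monus_prog [Comp (prefix_prog e') [Succ], Comp (prefix_prog e) [Succ]], d, d']"

lemma eval_select_prog:
  assumes "\<And>k. eval p e [k] (of_bool (x k))" and "\<And>k. eval p e' [k] (of_bool (y k))"
    and "eval p d [k] a" and "eval p d' [k] b"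
  shows "eval p (select_prog e e' d d') [k]
    (if prefix_value x (Suc k) \<le> prefix_value y (Suc k) then a else b)"
proof -
  have "eval p (Comp monus_prog [Comp (prefix_prog e') [Succ], Comp (prefix_prog e) [Succ]]) [k]
      (prefix_value x (Suc k) - prefix_value y (Suc k))"
    by (intro eval_Comp2[OF _ _ eval_monus_prog] eval_Comp1[OF eval.Succ] eval_prefix_prog assms)
  from eval_Comp3[OF this assms(3,4) eval_cond_prog]
  show ?thesis
    by (simp add: select_prog_def del: prefix_value.simps)
qed

lemma prefix_value_cong: "(\<And>i. i < k \<Longrightarrow> x i = y i) \<Longrightarrow> prefix_value x k = prefix_value y k"
  by (induction k) auto

text \<open>Bit i creates a gap of 1. Each later bit doubles the gap to at least 2, which a single
  new bit cannot close.\<close>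

lemma prefix_value_less:
  assumes "i < k" and "\<not> x i" and "y i" and "\<And>j. j < i \<Longrightarrow> x j = y j"
  shows "prefix_value x k < prefix_value y k"
  using assms(1)
proof (induction k)
  case (Suc k)
  show ?case
  proof (cases "i = k")
    case True
    then have "prefix_value x k = prefix_value y k"
      using assms(4) by (intro prefix_value_cong) simp
    then show ?thesis using True assms(2,3) by simp
  next
    case False
    then have "prefix_value x k < prefix_value y k" using Suc by simp
    then show ?thesis by (simp add: of_bool_def)
  qed
qed simp

section \<open>Lexicographic comparison through finite prefixes\<close>

lemma less_fun_cantor_iff:
  "less_fun x y \<longleftrightarrow> (\<exists>i. \<not> x i \<and> y i \<and> (\<forall>j<i. x j = y j))" for x y :: cantor
  by (auto simp: less_fun_def)

lemma less_fun_cantor_linear: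
  fixes x y :: cantor
  shows "less_fun x y \<or> x = y \<or> less_fun y x"
proof (cases "x = y")
  case False
  then have "\<exists>i. x i \<noteq> y i" by auto
  then obtain i where "x i \<noteq> y i" "\<forall>j<i. x j = y j"
    using exists_least_iff[of "\<lambda>i. x i \<noteq> y i"] by blast
  then show ?thesis by (auto simp: less_fun_cantor_iff)
qed simp

text \<open>Prefixes agree before the first difference and are ordered like x and y from there on.
  Hence the reverse inequality can only be a tie, which puts the first difference after position
  k.\<close>

lemma prefix_value_compare:
  fixes x y :: cantor
  assumes "less_fun x y"
  shows "prefix_value x (Suc k) \<le> prefix_value y (Suc k)"
    and "prefix_value y (Suc k) \<le> prefix_value x (Suc k) \<Longrightarrow> x k = y k"
proof -
  from assms obtain i where i: "\<not> x i" "y i" "\<And>j. j < i \<Longrightarrow> x j = y j"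
    by (auto simp: less_fun_cantor_iff)
  have less: "prefix_value x (Suc k) < prefix_value y (Suc k)" if "i \<le> k"
    by (rule prefix_value_less[of i]) (use that i in auto)
  have eq: "prefix_value x (Suc k) = prefix_value y (Suc k)" "x k = y k" if "k < i"
    using that i(3) by (auto intro!: prefix_value_cong simp del: prefix_value.simps)
  show "prefix_value x (Suc k) \<le> prefix_value y (Suc k)"
    using less eq(1) by (cases "i \<le> k") (simp_all del: prefix_value.simps)
  show "x k = y k" if "prefix_value y (Suc k) \<le> prefix_value x (Suc k)"
    using less eq(2) that by (cases "i \<le> k") (simp_all del: prefix_value.simps)
qed

definition lex_max :: "cantor \<Rightarrow> cantor \<Rightarrow> cantor" where
  "lex_max x y = (if less_fun x y then y else x)"

definition lex_min :: "cantor \<Rightarrow> cantor \<Rightarrow> cantor" where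
  "lex_min x y = (if less_fun x y then x else y)"

text \<open>Bit k of the maximum or minimum is found from k + 1 bits without deciding the order of x
  and y: as long as the prefixes tie, both choices give the same bit.\<close>

lemma lex_max_nth:
  "lex_max x y k = (if prefix_value x (Suc k) \<le> prefix_value y (Suc k) then y k else x k)"
  and lex_min_nth:
  "lex_min x y k = (if prefix_value x (Suc k) \<le> prefix_value y (Suc k) then x k else y k)"
  using less_fun_cantor_linear[of x y] prefix_value_compare[of x y k] prefix_value_compare[of y x k]
  by (auto simp: lex_max_def lex_min_def simp del: prefix_value.simps)

lemma step_mono: "less_fun x y \<Longrightarrow> step \<alpha> x \<Longrightarrow> step \<alpha> y"
  unfolding step_def using less_fun_trans by blast

text \<open>The step function is monotone on a linear order, so it commutes with maximum and
  minimum.\<close>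

lemma step_lex_max: "step \<alpha> (lex_max x y) \<longleftrightarrow> step \<alpha> x \<or> step \<alpha> y"
  and step_lex_min: "step \<alpha> (lex_min x y) \<longleftrightarrow> step \<alpha> x \<and> step \<alpha> y"
  using less_fun_cantor_linear[of x y] step_mono[of x y \<alpha>] step_mono[of y x \<alpha>]
  by (auto simp: lex_max_def lex_min_def)

section \<open>Monotone combinations of thresholds\<close>

text \<open>The oracle of \<open>e\<close> holds only the inputs, so \<alpha> itself need not be
  computable; \<open>c\<close> is the map that \<open>e\<close> computes.\<close>

definition realizable :: "cantor \<Rightarrow> nat \<Rightarrow> truth_table \<Rightarrow> bool" where
  "realizable \<alpha> n M \<longleftrightarrow> (\<exists>e c. \<forall>xs. length xs = n \<longrightarrow>
     (\<forall>k. eval (name (map Seq xs)) e [k] (of_bool (c xs k))) \<and>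
     step \<alpha> (c xs) = M (map (step \<alpha>) xs))"

lemma realizable_cong:
  assumes "realizable \<alpha> n M" and "\<And>v. length v = n \<Longrightarrow> M v = M' v"
  shows "realizable \<alpha> n M'"
proof -
  from assms(1) obtain e c where
    "\<And>xs. length xs = n \<Longrightarrow> (\<forall>k. eval (name (map Seq xs)) e [k] (of_bool (c xs k))) \<and>
     step \<alpha> (c xs) = M (map (step \<alpha>) xs)"
    unfolding realizable_def by blast
  then show ?thesis
    unfolding realizable_def using assms(2) by (intro exI[of _ e] exI[of _ c]) simp
qed

lemma realizable_nth:
  assumes "j < n"
  shows "realizable \<alpha> n (\<lambda>v. v ! j)"
proof -
  let ?e = "Comp Oracle [const_prog j, Proj 0]"
  have "eval (name (map Seq xs)) ?e [k] (of_bool ((xs ! j) k))" if "length xs = n" for xs k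
  proof -
    have "eval (name (map Seq xs)) ?e [k] (name (map Seq xs) j k)"
      by (rule eval_Comp2[OF eval_const_prog eval_Proj eval.Oracle]) simp_all
    then show ?thesis using that assms by (simp add: name_def)
  qed
  then show ?thesis
    unfolding realizable_def using assms by (intro exI[of _ ?e] exI[of _ "\<lambda>xs. xs ! j"]) simp
qed

text \<open>The constant sequence 1 is the lexicographic maximum, hence never below
  \<alpha>.\<close>

lemma realizable_True: "realizable \<alpha> n (\<lambda>v. True)"
proof -
  have "step \<alpha> (\<lambda>_. True)"
    by (simp add: step_def less_fun_cantor_iff)
  moreover have "eval p (const_prog 1) [k] 1" for p k
    by (rule eval_const_prog)
  ultimately show ?thesis
    unfolding realizable_def
    by (intro exI[of _ "const_prog 1"] exI[of _ "\<lambda>_ _. True"]) simp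
qed

text \<open>The zero sequence lies strictly below \<alpha>, because a proper sequence contains a
  1.\<close>

lemma realizable_False:
  assumes "proper \<alpha>"
  shows "realizable \<alpha> n (\<lambda>v. False)"
proof -
  have "\<exists>i. \<alpha> i"
    using assms infinite_imp_nonempty unfolding proper_def by blast
  then obtain i where "\<alpha> i" "\<forall>j<i. \<not> \<alpha> j"
    using exists_least_iff[of \<alpha>] by blast
  then have "\<not> step \<alpha> (\<lambda>_. False)"
    by (auto simp: step_def less_fun_cantor_iff)
  then show ?thesis
    unfolding realizable_def
    by (intro exI[of _ Zero] exI[of _ "\<lambda>_ _. False"]) (simp add: eval.Zero)
qed

text \<open>The minimum realizes the conjunction and the maximum the disjunction; the two programs
  differ only in the order of the output branches.\<close>

lemma realizable_conj_disj:
  assumes "realizable \<alpha> n M" and "realizable \<alpha> n M'"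
  shows realizable_conj: "realizable \<alpha> n (\<lambda>v. M v \<and> M' v)"
    and realizable_disj: "realizable \<alpha> n (\<lambda>v. M v \<or> M' v)"
proof -
  from assms obtain e c e' c' where
    e: "\<And>xs k. length xs = n \<Longrightarrow> eval (name (map Seq xs)) e [k] (of_bool (c xs k))" and
    c: "\<And>xs. length xs = n \<Longrightarrow> step \<alpha> (c xs) = M (map (step \<alpha>) xs)" and
    e': "\<And>xs k. length xs = n \<Longrightarrow> eval (name (map Seq xs)) e' [k] (of_bool (c' xs k))" and
    c': "\<And>xs. length xs = n \<Longrightarrow> step \<alpha> (c' xs) = M' (map (step \<alpha>) xs)"
    unfolding realizable_def by metis
  have "eval (name (map Seq xs)) (select_prog e e' e e') [k] (of_bool (lex_min (c xs) (c' xs) k))"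
    if "length xs = n" for xs k
    using eval_select_prog[OF e e' e e', OF that that that that, of k]
    by (simp add: lex_min_nth if_distrib del: prefix_value.simps)
  then show "realizable \<alpha> n (\<lambda>v. M v \<and> M' v)"
    unfolding realizable_def
    by (intro exI[of _ "select_prog e e' e e'"] exI[of _ "\<lambda>xs. lex_min (c xs) (c' xs)"])
      (simp add: step_lex_min c c')
  have "eval (name (map Seq xs)) (select_prog e e' e' e) [k] (of_bool (lex_max (c xs) (c' xs) k))"
    if "length xs = n" for xs k
    using eval_select_prog[OF e e' e' e, OF that that that that, of k]
    by (simp add: lex_max_nth if_distrib del: prefix_value.simps)
  then show "realizable \<alpha> n (\<lambda>v. M v \<or> M' v)"
    unfolding realizable_def
    by (intro exI[of _ "select_prog e e' e' e"] exI[of _ "\<lambda>xs. lex_max (c xs) (c' xs)"])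
      (simp add: step_lex_max c c')
qed

lemma realizable_Ball:
  assumes "finite I" and "\<And>i. i \<in> I \<Longrightarrow> realizable \<alpha> n (M i)"
  shows "realizable \<alpha> n (\<lambda>v. \<forall>i\<in>I. M i v)"
  using assms by (induction I) (simp_all add: realizable_True realizable_conj)

lemma realizable_Bex:
  assumes "proper \<alpha>" and "finite I" and "\<And>i. i \<in> I \<Longrightarrow> realizable \<alpha> n (M i)"
  shows "realizable \<alpha> n (\<lambda>v. \<exists>i\<in>I. M i v)"
  using assms(2,3) by (induction I) (simp_all add: realizable_False[OF assms(1)] realizable_disj)

section \<open>Monotone truth-tables\<close>

lemma bits_le_iff: "bits_le v w \<longleftrightarrow> length v = length w \<and> (\<forall>j<length v. v ! j \<longrightarrow> w ! j)"
  by (auto simp: bits_le_def list_all2_conv_all_nth)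

lemma bits_le_refl: "bits_le v v"
  by (simp add: bits_le_iff)

lemma bits_le_trans: "bits_le u v \<Longrightarrow> bits_le v w \<Longrightarrow> bits_le u w"
  by (auto simp: bits_le_iff)

text \<open>A monotone table has a disjunctive normal form without negations: \<open>M v\<close>
  holds iff v lies above some u with \<open>M u\<close>, that is, iff v is 1 wherever u is. The
  vector v itself is such a u when \<open>M v\<close> holds.\<close>

lemma realizable_mono:
  assumes "proper \<alpha>"
    and mono: "\<And>v w. length w = n \<Longrightarrow> bits_le v w \<Longrightarrow> M v \<Longrightarrow> M w"
  shows "realizable \<alpha> n M"
proof -
  let ?U = "{u. length u = n \<and> M u}"
  have "finite {u :: bool list. length u = n}"
    using finite_lists_length_eq[of "UNIV :: bool set" n] by simp
  then have "finite ?U"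
    by (rule rev_finite_subset) auto
  then have "realizable \<alpha> n (\<lambda>v. \<exists>u\<in>?U. \<forall>j\<in>{j. j < n \<and> u ! j}. v ! j)"
    by (intro realizable_Bex realizable_Ball realizable_nth assms(1)) auto
  moreover have "(\<exists>u\<in>?U. \<forall>j\<in>{j. j < n \<and> u ! j}. v ! j) \<longleftrightarrow> M v" if "length v = n" for v
  proof
    assume "\<exists>u\<in>?U. \<forall>j\<in>{j. j < n \<and> u ! j}. v ! j"
    then obtain u where "length u = n" "M u" "\<forall>j<n. u ! j \<longrightarrow> v ! j" by auto
    with that show "M v" by (intro mono[of v u]) (auto simp: bits_le_iff)
  next
    assume "M v"
    with that show "\<exists>u\<in>?U. \<forall>j\<in>{j. j < n \<and> u ! j}. v ! j" by (intro bexI[of _ v]) auto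
  qed
  ultimately show ?thesis
    by (rule realizable_cong)
qed

section \<open>Reductions\<close>

lemma points_Cantor_iff: "x \<in> points (replicate n Cantor) \<longleftrightarrow> (\<exists>xs. length xs = n \<and> x = map Seq xs)"
proof
  assume "x \<in> points (replicate n Cantor)"
  then have x: "map factor_of x = replicate n Cantor" by (simp add: points_def)
  then have "factor_of c = Cantor" if "c \<in> set x" for c
    using that by (metis image_eqI in_set_replicate set_map)
  then have "Seq (seq c) = c" if "c \<in> set x" for c
    using that by (cases c) fastforce+
  then have "map Seq (map seq x) = x"
    by (simp add: map_idI)
  moreover have "length (map seq x) = n"
    using arg_cong[OF x, of length] by simp
  ultimately show "\<exists>xs. length xs = n \<and> x = map Seq xs"
    by metis
qed (auto simp: points_def comp_def map_replicate_const)

lemma map2_step_replicate: "length xs = n \<Longrightarrow> map2 step (replicate n \<alpha>) xs = map (step \<alpha>) xs"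
  by (rule nth_equalityI) simp_all

lemma step_table_replicate:
  assumes "length xs = n"
  shows "step_table G (replicate n \<alpha>) (map Seq xs) = Some [Bit (G (map (step \<alpha>) xs))]"
proof -
  have "map seq (map Seq xs) = xs"
    by (simp add: comp_def)
  moreover have "map Seq xs \<in> points (replicate n Cantor)"
    using assms points_Cantor_iff by blast
  ultimately show ?thesis
    using assms by (simp add: step_table_def map2_step_replicate del: map_map)
qed

text \<open>The outer functional of both reductions: it adds a constant modulo 2 and sees only the
  answer, which makes the reductions strong.\<close>

definition flip_bit :: "bool \<Rightarrow> point \<rightharpoonup> point" where
  "flip_bit b x = (case x of [Bit d] \<Rightarrow> Some [Bit (d \<noteq> b)] | _ \<Rightarrow> None)"

lemma flip_bit_eq_Some_iff: "flip_bit b x = Some y \<longleftrightarrow> (\<exists>d. x = [Bit d] \<and> y = [Bit (d \<noteq> b)])"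
  by (auto simp: flip_bit_def split: list.splits component.splits)

lemma computable_flip_bit: "computable_functional (flip_bit b)"
proof -
  \<comment> \<open>A bit is named by a constant function, so querying component 0 at position 0
    suffices, whatever output position is asked for.\<close>
  let ?e = "Comp cond_prog [Comp Oracle [Zero, Zero], const_prog (of_bool b), const_prog (of_bool (\<not> b))]"
  have ev: "eval (name [Bit d]) ?e [j, k] (of_bool (d \<noteq> b))" for d j k
  proof -
    have "eval (name [Bit d]) (Comp Oracle [Zero, Zero]) [j, k] (name [Bit d] 0 0)"
      by (rule eval_Comp2[OF eval.Zero eval.Zero eval.Oracle])
    from eval_Comp3[OF this eval_const_prog eval_const_prog eval_cond_prog]
    have "eval (name [Bit d]) ?e [j, k]
        (if name [Bit d] 0 0 = 0 then of_bool b else of_bool (\<not> b))" .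
    moreover have "(if name [Bit d] 0 0 = 0 then of_bool b else of_bool (\<not> b)) =
        (of_bool (d \<noteq> b) :: nat)"
      by (simp add: name_def)
    ultimately show ?thesis by simp
  qed
  have "dom (flip_bit b) \<subseteq> points [Bits]" "ran (flip_bit b) \<subseteq> points [Bits]"
    by (auto simp: dom_def ran_def flip_bit_eq_Some_iff points_def)
  then show ?thesis
    unfolding computable_functional_def
    by (intro conjI exI[of _ ?e]) (use ev in \<open>auto simp: flip_bit_eq_Some_iff name_def\<close>)
qed

text \<open>Each \<open>M i\<close> is realized by a program that turns the inputs into one
  sequence. The m sequences are the query to the other table, whose answer is corrected by the
  constant \<open>b\<close>.\<close>

lemma strong_Weihrauch_le_by_monotone:
  assumes "proper \<alpha>"
    and mono: "\<And>i v w. i < m \<Longrightarrow> length w = n \<Longrightarrow> bits_le v w \<Longrightarrow> M i v \<Longrightarrow> M i w"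
    and G: "\<And>v. length v = n \<Longrightarrow> G v \<longleftrightarrow> H (map (\<lambda>i. M i v) [0..<m]) \<noteq> b"
  shows "step_table G (replicate n \<alpha>) \<le>\<^sub>s\<^sub>W step_table H (replicate m \<alpha>)"
proof -
  have "\<forall>i<m. \<exists>e c. \<forall>xs. length xs = n \<longrightarrow>
     (\<forall>k. eval (name (map Seq xs)) e [k] (of_bool (c xs k))) \<and>
     step \<alpha> (c xs) = M i (map (step \<alpha>) xs)"
    using realizable_mono[OF assms(1)] mono unfolding realizable_def by metis
  then obtain e c where
    e: "\<And>i xs k. i < m \<Longrightarrow> length xs = n \<Longrightarrow>
      eval (name (map Seq xs)) (e i) [k] (of_bool (c i xs k))" and
    c: "\<And>i xs. i < m \<Longrightarrow> length xs = n \<Longrightarrow> step \<alpha> (c i xs) = M i (map (step \<alpha>) xs)"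
    by metis
  \<comment> \<open>The restriction to tuples of n sequences keeps the domain inside a single
    product space.\<close>
  define \<Phi> where "\<Phi> x = (if x \<in> points (replicate n Cantor)
    then Some (map Seq (map (\<lambda>i. c i (map seq x)) [0..<m])) else None)" for x
  have \<Phi>: "\<Phi> (map Seq xs) = Some (map Seq (map (\<lambda>i. c i xs) [0..<m]))" if "length xs = n" for xs
  proof -
    have "map seq (map Seq xs) = xs"
      by (simp add: comp_def)
    moreover have "map Seq xs \<in> points (replicate n Cantor)"
      using that points_Cantor_iff by blast
    ultimately show ?thesis
      by (simp add: \<Phi>_def del: map_map)
  qed
  have \<Phi>_SomeE: "\<exists>xs. length xs = n \<and> x = map Seq xs \<and> y = map Seq (map (\<lambda>i. c i xs) [0..<m])"
    if "\<Phi> x = Some y" for x y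
  proof -
    have "x \<in> points (replicate n Cantor)"
      using that by (auto simp: \<Phi>_def split: if_splits)
    then obtain xs where "length xs = n" "x = map Seq xs"
      using points_Cantor_iff by blast
    with that \<Phi> show ?thesis by auto
  qed
  have "computable_functional \<Phi>"
    unfolding computable_functional_def
  proof (intro conjI exI allI impI)
    show "dom \<Phi> \<subseteq> points (replicate n Cantor)"
      by (auto simp: \<Phi>_def split: if_splits)
    show "ran \<Phi> \<subseteq> points (replicate m Cantor)"
    proof
      fix y assume "y \<in> ran \<Phi>"
      then obtain x where "\<Phi> x = Some y" by (auto simp: ran_def)
      from \<Phi>_SomeE[OF this] obtain xs where "y = map Seq (map (\<lambda>i. c i xs) [0..<m])" by blast
      then show "y \<in> points (replicate m Cantor)"
        unfolding points_Cantor_iff by (intro exI[of _ "map (\<lambda>i. c i xs) [0..<m]"]) simp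
    qed
  next
    fix x y j k
    assume "\<Phi> x = Some y" and j: "j < length y"
    from \<Phi>_SomeE[OF this(1)] obtain xs where
      xs: "length xs = n" "x = map Seq xs" "y = map Seq (map (\<lambda>i. c i xs) [0..<m])" by blast
    \<comment> \<open>Output component j is delegated to \<open>e j\<close>; the default 0 is not
      reached, since j is below the length of y.\<close>
    have "eval (name x) (case_prog (map e [0..<m])) [j, k]
        (if j < length (map e [0..<m]) then of_bool (c j xs k) else 0)"
      using e[OF _ xs(1)] xs(2) by (intro eval_case_prog) simp
    then show "eval (name x) (case_prog (map e [0..<m])) [j, k] (name y j k)"
      using j xs(3) by (simp add: name_def)
  qed
  moreover have "step_table G (replicate n \<alpha>) x =
      (flip_bit b \<circ>\<^sub>m (step_table H (replicate m \<alpha>) \<circ>\<^sub>m \<Phi>)) x"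
    if "x \<in> dom (step_table G (replicate n \<alpha>))" for x
  proof -
    from that have "x \<in> points (replicate n Cantor)"
      by (auto simp: step_table_def split: if_splits)
    then obtain xs where xs: "length xs = n" "x = map Seq xs"
      using points_Cantor_iff by blast
    let ?ys = "map (\<lambda>i. c i xs) [0..<m]"
    have "map (step \<alpha>) ?ys = map (\<lambda>i. M i (map (step \<alpha>) xs)) [0..<m]"
      using c xs(1) by (simp del: map_map add: list_eq_iff_nth_eq)
    then have "step_table H (replicate m \<alpha>) (map Seq ?ys) =
        Some [Bit (H (map (\<lambda>i. M i (map (step \<alpha>) xs)) [0..<m]))]"
      using step_table_replicate[of ?ys m H \<alpha>] by (simp del: map_map)
    moreover have "step_table G (replicate n \<alpha>) x =
        Some [Bit (H (map (\<lambda>i. M i (map (step \<alpha>) xs)) [0..<m]) \<noteq> b)]"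
      using G[of "map (step \<alpha>) xs"] step_table_replicate xs by simp
    ultimately show ?thesis
      using \<Phi>[OF xs(1)] xs(2) by (simp add: map_comp_def flip_bit_def del: map_map)
  qed
  ultimately show ?thesis
    unfolding strong_Weihrauch_le_def using computable_flip_bit by blast
qed

section \<open>Alternating chains\<close>

lemma parity_eq: "parity v \<longleftrightarrow> odd (count_list v True)"
proof -
  have "(\<Sum>b\<leftarrow>v. of_bool b) = count_list v True"
    by (induction v) auto
  then show ?thesis by (simp add: parity_def)
qed

section \<open>Longest alternating chains\<close>

lemma alternating_chain_length_le:
  assumes "alternating_chain n F vs"
  shows "length vs \<le> alternation n F + 1"
  using Max_ge[OF finite_alternating_chain_lengths, of "length vs" n F] assms
  by (auto simp: alternation_def)

lemma exists_longest_alternating_chain: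
  "\<exists>vs. alternating_chain n F vs \<and> length vs = alternation n F + 1"
proof -
  let ?L = "length ` {vs. alternating_chain n F vs}"
  \<comment> \<open>A singleton chain makes the maximum positive, so the truncated subtraction in
    \<open>alternation\<close> is exact.\<close>
  have one: "1 \<in> ?L"
    using alternating_chain_singleton[of "replicate n False" n F]
    by (intro image_eqI[of _ _ "[replicate n False]"]) simp_all
  then have "Max ?L \<in> ?L"
    by (intro Max_in finite_alternating_chain_lengths) auto
  moreover have "1 \<le> Max ?L"
    using one by (intro Max_ge finite_alternating_chain_lengths)
  ultimately show ?thesis
    by (auto simp: alternation_def)
qed

lemma alternating_chain_value:
  assumes "alternating_chain n F vs" and "i < length vs"
  shows "F (vs ! i) \<longleftrightarrow> F (vs ! 0) \<noteq> odd i"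
  using assms(2)
proof (induction i)
  case (Suc i)
  then have "F (vs ! i) \<noteq> F (vs ! Suc i)"
    using assms(1) by (simp add: alternating_chain_def successively_conv_nth)
  with Suc show ?case by auto
qed simp

lemma alternating_chain_mono:
  assumes "alternating_chain n F vs" and "i \<le> j" and "j < length vs"
  shows "bits_le (vs ! i) (vs ! j)"
  using assms(2,3)
proof (induction j rule: dec_induct)
  case (step j)
  then have "bits_le (vs ! j) (vs ! Suc j)"
    using assms(1) by (simp add: alternating_chain_def successively_conv_nth bits_less_def)
  with step show ?case
    using bits_le_trans by simp
qed (rule bits_le_refl)

text \<open>Strictness comes for free: different values of \<open>F\<close> force different
  vectors.\<close>

lemma alternating_chain_snoc:
  assumes "alternating_chain n F vs" and "vs \<noteq> []" and "length v = n"
    and "bits_le (last vs) v" and "F (last vs) \<noteq> F v"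
  shows "alternating_chain n F (vs @ [v])"
  using assms by (auto simp: alternating_chain_def successively_append_iff bits_less_def)

text \<open>Fixing the value of \<open>F\<close> at the head lets the parity of the number of
  alternations determine the value at the end. The chain need not start at the zero vector
  itself.\<close>

definition alternations_below :: "nat \<Rightarrow> truth_table \<Rightarrow> bool list \<Rightarrow> nat" where
  "alternations_below n F v = Max ((\<lambda>vs. length vs - 1) ` {vs. alternating_chain n F vs \<and> vs \<noteq> [] \<and>
     F (hd vs) = F (replicate n False) \<and> bits_le (last vs) v})"

lemma finite_alternations_below:
  "finite ((\<lambda>vs. length vs - 1) ` {vs. alternating_chain n F vs \<and> vs \<noteq> [] \<and>
     F (hd vs) = F (replicate n False) \<and> bits_le (last vs) v})"
  by (rule finite_subset[of _ "{..n}"]) (use alternating_chain_length in fastforce)+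

lemma alternations_below_ge:
  assumes "alternating_chain n F vs" "vs \<noteq> []" "F (hd vs) = F (replicate n False)"
    "bits_le (last vs) v"
  shows "length vs - 1 \<le> alternations_below n F v"
  unfolding alternations_below_def
  by (rule Max_ge[OF finite_alternations_below]) (use assms in auto)

lemma alternations_belowE:
  assumes "length v = n"
  obtains vs where "alternating_chain n F vs" "vs \<noteq> []" "F (hd vs) = F (replicate n False)"
    "bits_le (last vs) v" "alternations_below n F v = length vs - 1"
proof -
  let ?C = "{vs. alternating_chain n F vs \<and> vs \<noteq> [] \<and>
     F (hd vs) = F (replicate n False) \<and> bits_le (last vs) v}"
  \<comment> \<open>The zero vector alone is an admissible chain below every v, so the maximum is
    attained.\<close>
  have "[replicate n False] \<in> ?C"
    using assms alternating_chain_singleton[of "replicate n False" n F]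
    by (simp add: bits_le_iff)
  then have "alternations_below n F v \<in> (\<lambda>vs. length vs - 1) ` ?C"
    unfolding alternations_below_def by (intro Max_in[OF finite_alternations_below]) blast
  then show ?thesis
    using that by blast
qed

lemma alternations_below_mono:
  assumes "length w = n" and "bits_le v w"
  shows "alternations_below n F v \<le> alternations_below n F w"
proof -
  have "length v = n" using assms by (simp add: bits_le_iff)
  then obtain vs where "alternating_chain n F vs" "vs \<noteq> []" "F (hd vs) = F (replicate n False)"
    "bits_le (last vs) v" "alternations_below n F v = length vs - 1"
    by (rule alternations_belowE)
  then show ?thesis
    using alternations_below_ge[of n F vs w] bits_le_trans[OF _ assms(2)] by simp
qed

lemma alternations_below_le:
  assumes "length v = n"
  shows "alternations_below n F v \<le> alternation n F"
  using assms
proof (rule alternations_belowE)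
  fix vs assume "alternating_chain n F vs" "alternations_below n F v = length vs - 1"
  then show ?thesis using alternating_chain_length_le[of n F vs] by simp
qed

lemma odd_alternations_below:
  assumes "length v = n"
  shows "F v \<longleftrightarrow> odd (alternations_below n F v) \<noteq> F (replicate n False)"
  using assms
proof (rule alternations_belowE)
  fix vs
  assume vs: "alternating_chain n F vs" "vs \<noteq> []" "F (hd vs) = F (replicate n False)"
    "bits_le (last vs) v" "alternations_below n F v = length vs - 1"
  have "F (last vs) = F v"
  proof (rule ccontr)
    assume "F (last vs) \<noteq> F v"
    then have "alternating_chain n F (vs @ [v])"
      by (rule alternating_chain_snoc[OF vs(1,2) assms vs(4)])
    \<comment> \<open>The prolonged chain also ends below v but has one alternation more than the
      maximum.\<close>
    then have "length (vs @ [v]) - 1 \<le> alternations_below n F v"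
      using vs by (intro alternations_below_ge) (simp_all add: bits_le_refl)
    then show False using vs(2,5) by (cases vs) simp_all
  qed
  moreover have "F (last vs) \<longleftrightarrow> F (hd vs) \<noteq> odd (length vs - 1)"
    using alternating_chain_value[OF vs(1), of "length vs - 1"] vs(2)
    by (simp add: last_conv_nth hd_conv_nth)
  ultimately show ?thesis using vs(3,5) by auto
qed

section \<open>The two reductions\<close>

lemma step_table_le_parity:
  assumes "proper \<alpha>"
  shows "step_table F (replicate n \<alpha>)
    \<le>\<^sub>s\<^sub>W step_table parity (replicate (alternation n F) \<alpha>)"
proof (rule strong_Weihrauch_le_by_monotone[OF assms,
      where M = "\<lambda>i v. i < alternations_below n F v" and b = "F (replicate n False)"])
  fix i v w
  assume "length w = n" "bits_le v w" "i < alternations_below n F v"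
  then show "i < alternations_below n F w"
    using alternations_below_mono[of w n v F] by simp
next
  fix v :: "bool list"
  assume v: "length v = n"
  \<comment> \<open>With a at most m, exactly a of the conditions \<open>i < a\<close> hold, so the
    parity of the list is that of a.\<close>
  have "count_list (map (\<lambda>i. i < a) [0..<m]) True = min a m" for a m :: nat
    by (induction m) (auto simp: min_def)
  then have "parity (map (\<lambda>i. i < alternations_below n F v) [0..<alternation n F]) \<longleftrightarrow>
      odd (alternations_below n F v)"
    using alternations_below_le[OF v, of F] by (simp add: parity_eq)
  then show "F v \<longleftrightarrow> parity (map (\<lambda>i. i < alternations_below n F v) [0..<alternation n F])
      \<noteq> F (replicate n False)"
    using odd_alternations_below[OF v, of F] by simp
qed

lemma parity_le_step_table:
  assumes "proper \<alpha>"
  shows "step_table parity (replicate (alternation n F) \<alpha>) \<le>\<^sub>s\<^sub>W step_table F (replicate n \<alpha>)"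
proof -
  obtain vs where vs: "alternating_chain n F vs" "length vs = alternation n F + 1"
    using exists_longest_alternating_chain by blast
  have len: "length (vs ! i) = n" if "i < length vs" for i
    using that vs(1) by (simp add: alternating_chain_def)
  \<comment> \<open>The chain has one entry for each possible number of ones, from 0 to
    \<open>alternation n F\<close>.\<close>
  have count: "count_list v True < length vs" if "length v = alternation n F" for v
    using count_le_length[of v True] that vs(2) by simp
  show ?thesis
  proof (rule strong_Weihrauch_le_by_monotone[OF assms,
        where M = "\<lambda>j v. vs ! count_list v True ! j" and b = "F (vs ! 0)"])
    fix j v w
    assume j: "j < n" and w: "length w = alternation n F" and "bits_le v w"
      and v: "vs ! count_list v True ! j"
    \<comment> \<open>Strictly comparable vectors have strictly ordered counts; equal vectors are
      split off.\<close>
    then have "count_list v True \<le> count_list w True"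
      using bits_less_count[of v w] by (cases "v = w") (simp_all add: bits_less_def)
    then have "bits_le (vs ! count_list v True) (vs ! count_list w True)"
      using alternating_chain_mono[OF vs(1)] count[OF w] by blast
    then show "vs ! count_list w True ! j"
      using j v len[OF count[OF w]] by (simp add: bits_le_iff)
  next
    fix v :: "bool list"
    assume v: "length v = alternation n F"
    \<comment> \<open>The n coordinates, each computed by its own monotone condition, reassemble to
      the chain vector.\<close>
    have "map ((!) (vs ! count_list v True)) [0..<n] = vs ! count_list v True"
      using map_nth[of "vs ! count_list v True"] len[OF count[OF v]] by simp
    then show "parity v \<longleftrightarrow> F (map (\<lambda>j. vs ! count_list v True ! j) [0..<n]) \<noteq> F (vs ! 0)"
      using alternating_chain_value[OF vs(1) count[OF v]] by (auto simp: parity_eq)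
  qed
qed

theorem mainTheorem1:
  fixes n :: nat and F :: truth_table and \<alpha> :: cantor
  assumes "n > 1" and "proper \<alpha>"
  shows "step_table F (replicate n \<alpha>)
           \<equiv>\<^sub>s\<^sub>W step_table parity (replicate (alternation n F) \<alpha>)"
  unfolding strong_Weihrauch_equiv_def
  using step_table_le_parity[OF assms(2)] parity_le_step_table[OF assms(2)] by blast

end
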